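(* Let $R$ be a compact topological ring (associative, Hausdorff, not necessarily unital and not necessarily commutative). Then $A(R) = N(R)$, where $A(R)$ denotes the sum of all left nil ideals of $R$ and $N(R)$ denotes the upper nilradical of $R$, i.e. the sum of all two-sided nil ideals of $R$.
   Context: All rings are associative, but are not assumed to be unital or commutative. A topological ring is a pair $(R,\mathcal{T})$ where $R$ is a ring and $\mathcal{T}$ is a Hausdorff topology on $R$ such that $(R,+,\mathcal{T})$ is a topological group and multiplication $R\times R\to R$ is continuous. It is compact if the topology $\mathcal{T}$ is compact. A left nil ideal is a left ideal all of whose elements are nilpotent; a two-sided nil ideal is a two-sided ideal all of whose elements are nilpotent. The sums of ideals are purely algebraic (sets of finite sums of elements of the ideals; no topological closure is taken). *)

theory Defs
  imports "HOL-Analysis.Analysis"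
begin

(* The library power (^) needs a unit, which class ring does not provide:
   pow_Suc x n is the (n + 1)-st power of x. *)
primrec pow_Suc :: "'a::semigroup_mult \<Rightarrow> nat \<Rightarrow> 'a" where
  "pow_Suc x 0 = x"
| "pow_Suc x (Suc n) = x * pow_Suc x n"

definition nilpotent :: "'a::ring \<Rightarrow> bool" where
  "nilpotent x \<longleftrightarrow> (\<exists>n. pow_Suc x n = 0)"

definition additive_subgroup :: "'a::ring set \<Rightarrow> bool" where
  "additive_subgroup I \<longleftrightarrow>
     0 \<in> I \<and> (\<forall>x\<in>I. \<forall>y\<in>I. x + y \<in> I) \<and> (\<forall>x\<in>I. - x \<in> I)"

definition left_ideal :: "'a::ring set \<Rightarrow> bool" where
  "left_ideal I \<longleftrightarrow> additive_subgroup I \<and> (\<forall>r. \<forall>x\<in>I. r * x \<in> I)"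

definition two_sided_ideal :: "'a::ring set \<Rightarrow> bool" where
  "two_sided_ideal I \<longleftrightarrow>
     additive_subgroup I \<and> (\<forall>r. \<forall>x\<in>I. r * x \<in> I) \<and> (\<forall>r. \<forall>x\<in>I. x * r \<in> I)"

definition left_nil_ideal :: "'a::ring set \<Rightarrow> bool" where
  "left_nil_ideal I \<longleftrightarrow> left_ideal I \<and> (\<forall>x\<in>I. nilpotent x)"

definition two_sided_nil_ideal :: "'a::ring set \<Rightarrow> bool" where
  "two_sided_nil_ideal I \<longleftrightarrow> two_sided_ideal I \<and> (\<forall>x\<in>I. nilpotent x)"

definition sum_of_ideals :: "'a::ring set set \<Rightarrow> 'a set" where
  "sum_of_ideals \<I> = {sum_list xs | xs. set xs \<subseteq> \<Union>\<I>}"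

definition sum_left_nil_ideals :: "'a::ring set" where
  "sum_left_nil_ideals = sum_of_ideals {I. left_nil_ideal I}"

definition upper_nilradical :: "'a::ring set" where
  "upper_nilradical = sum_of_ideals {I. two_sided_nil_ideal I}"

end

theory Submission
  imports Defs
begin

text \<open>The upper nilradical is a semiprime ideal, so it suffices that a semiprime ideal \<open>Q\<close> contains
  every \<open>x\<close> for which all elements of \<open>R x\<close> are nilpotent. The closed sets \<open>{r. (r x)\<^sup>n = 0}\<close> cover \<open>R\<close>,
  so by Baire one of them contains \<open>r\<^sub>0 + I\<close>, where compactness allows us to choose \<open>I\<close> open, containing
  \<open>0\<close> and closed under multiplication by \<open>R\<close> from both sides (but not additively closed). With
  \<open>b = r\<^sub>0 x\<close> and \<open>J = I x\<close> we have \<open>R J \<subseteq> J\<close>, \<open>J b \<subseteq> J\<close> and \<open>(b + u)\<^sup>n = 0\<close> for \<open>u \<in> J\<close>. If \<open>u \<in> J\<close> and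
  \<open>u b \<in> Q\<close>, then \<open>u\<^sup>n\<^sup>+\<^sup>1 = u (b + u)\<^sup>n = 0\<close> modulo \<open>Q\<close>. The same holds for all elements of \<open>R u\<close>, whence
  \<open>u \<in> Q\<close> by Levitzki's theorem; as \<open>b\<close> is nilpotent, induction gives \<open>J \<subseteq> Q\<close>. Compactness also
  bounds the \<open>k\<close> for which \<open>(r x)\<^sup>k \<in> I\<close>, and then \<open>(r x)\<^sup>k\<^sup>+\<^sup>1 \<in> J \<subseteq> Q\<close>, so that a second application of
  Levitzki's theorem gives \<open>x \<in> Q\<close>.\<close>

section \<open>Powers in rings without unit\<close>

lemma pow_Suc_add: "pow_Suc x m * pow_Suc x n = pow_Suc x (Suc (m + n))"
  by (induction m) (simp_all add: mult.assoc)

lemma pow_Suc_pow_Suc: "pow_Suc (pow_Suc x m) n = pow_Suc x (m + n + m * n)"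
  by (induction n) (simp_all add: pow_Suc_add ac_simps)

lemma nilpotent_pow_SucD: "nilpotent (pow_Suc x n) \<Longrightarrow> nilpotent x"
  unfolding nilpotent_def by (auto simp: pow_Suc_pow_Suc)

lemma continuous_on_pow_Suc [continuous_intros]:
  fixes f :: "'b::topological_space \<Rightarrow> 'a::topological_semigroup_mult"
  assumes "continuous_on S f"
  shows "continuous_on S (\<lambda>x. pow_Suc (f x) n)"
  by (induction n) (simp_all add: assms continuous_on_mult')

section \<open>Ideals of subrings\<close>

definition subring :: "'a::ring set \<Rightarrow> bool" where
  "subring S \<longleftrightarrow> additive_subgroup S \<and> (\<forall>x\<in>S. \<forall>y\<in>S. x * y \<in> S)"

locale ring_ideal =
  fixes S T :: "'a::ring set"
  assumes subring: "subring S"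
    and additive_subgroup: "additive_subgroup T"
    and subset: "T \<subseteq> S"
    and lmult: "r \<in> S \<Longrightarrow> x \<in> T \<Longrightarrow> r * x \<in> T"
    and rmult: "x \<in> T \<Longrightarrow> r \<in> S \<Longrightarrow> x * r \<in> T"
begin

lemma subring_add: "x \<in> S \<Longrightarrow> y \<in> S \<Longrightarrow> x + y \<in> S"
  and subring_mult: "x \<in> S \<Longrightarrow> y \<in> S \<Longrightarrow> x * y \<in> S"
  using subring by (simp_all add: subring_def additive_subgroup_def)

lemma subring_pow_Suc: "x \<in> S \<Longrightarrow> pow_Suc x n \<in> S"
  by (induction n) (simp_all add: subring_mult)

lemma zero: "0 \<in> T"
  and add: "x \<in> T \<Longrightarrow> y \<in> T \<Longrightarrow> x + y \<in> T"
  and minus: "x \<in> T \<Longrightarrow> - x \<in> T"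
  using additive_subgroup by (simp_all add: additive_subgroup_def)

lemma add_iff: "x \<in> T \<Longrightarrow> x + y \<in> T \<longleftrightarrow> y \<in> T"
  using add[of x y] add[of "- x" "x + y"] by (auto simp: minus)

lemma mem_iff_if_diff_mem: "x - y \<in> T \<Longrightarrow> x \<in> T \<longleftrightarrow> y \<in> T"
  using add_iff[of "x - y" y] by simp

lemma pow_Suc_mono:
  assumes "x \<in> S" and "pow_Suc x m \<in> T" and "m \<le> n"
  shows "pow_Suc x n \<in> T"
  using assms(3,2) by (induction rule: dec_induct) (simp_all add: assms(1) lmult)

lemma pow_Suc_diff_mem:
  assumes "x \<in> S" and "y \<in> S" and "x - y \<in> T"
  shows "pow_Suc x n - pow_Suc y n \<in> T"
proof (induction n)
  case (Suc n)
  have "pow_Suc x (Suc n) - pow_Suc y (Suc n)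
      = (x - y) * pow_Suc x n + y * (pow_Suc x n - pow_Suc y n)"
    by (simp add: algebra_simps)
  then show ?case
    using Suc assms by (simp add: add lmult rmult subring_pow_Suc)
qed (simp add: assms)

lemma mult_pow_Suc_mem_iff:
  assumes "u \<in> S" and "v \<in> S" and "u * (v - u) \<in> T"
  shows "u * pow_Suc v n \<in> T \<longleftrightarrow> pow_Suc u (Suc n) \<in> T"
proof -
  have "u * pow_Suc v n - pow_Suc u (Suc n) \<in> T"
  proof (induction n)
    case 0
    then show ?case using assms(3) by (simp add: algebra_simps)
  next
    case (Suc n)
    have "u * pow_Suc v (Suc n) - pow_Suc u (Suc (Suc n))
        = u * (v - u) * pow_Suc v n + u * (u * pow_Suc v n - pow_Suc u (Suc n))"
      by (simp add: algebra_simps)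
    then show ?case
      using Suc assms by (simp only: add lmult rmult subring_pow_Suc)
  qed
  then show ?thesis by (rule mem_iff_if_diff_mem)
qed

lemma square_zero_mult_pow_Suc_mem:
  assumes bounded_index: "\<And>y. y \<in> S \<Longrightarrow> pow_Suc y (Suc n) \<in> T"
    and "a \<in> S" and "a * a \<in> T" and "x \<in> S"
  shows "a * pow_Suc (x * a) n \<in> T"
proof -
  define z where "z = x * a + a"
  have mem: "x * a \<in> S" "z \<in> S"
    using assms by (simp_all add: z_def subring_add subring_mult)
  have "- (x * (a * a) + a * a) \<in> T"
    using assms by (simp only: minus add lmult)
  also have "- (x * (a * a) + a * a) = z * (x * a - z)"
    by (simp add: z_def algebra_simps)
  finally have "z * pow_Suc (x * a) n \<in> T"
    using mem bounded_index by (simp only: mult_pow_Suc_mem_iff)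
  then have "pow_Suc (x * a) (Suc n) + a * pow_Suc (x * a) n \<in> T"
    by (simp add: z_def distrib_right)
  then show ?thesis
    using bounded_index[OF mem(1)] by (simp only: add_iff)
qed

definition left_multiples :: "'a \<Rightarrow> 'a set" where
  "left_multiples a = (\<lambda>r. r * a) ` S"

definition right_annihilator :: "'a \<Rightarrow> 'a set" where
  "right_annihilator a = {y \<in> left_multiples a. a * y \<in> T}"

lemma left_multiples_subset: "a \<in> S \<Longrightarrow> left_multiples a \<subseteq> S"
  by (auto simp: left_multiples_def subring_mult)

lemma mult_left_multiples: "x \<in> S \<Longrightarrow> y \<in> left_multiples a \<Longrightarrow> x * y \<in> left_multiples a"
  by (auto simp: left_multiples_def subring_mult simp flip: mult.assoc)

lemma subring_left_multiples:
  assumes "a \<in> S"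
  shows "subring (left_multiples a)"
proof -
  have "0 \<in> S" and "x \<in> S \<Longrightarrow> - x \<in> S" for x
    using subring by (simp_all add: subring_def additive_subgroup_def)
  then have "0 * a \<in> left_multiples a" "x \<in> left_multiples a \<Longrightarrow> - x \<in> left_multiples a" for x
    unfolding left_multiples_def by (blast, force simp flip: mult_minus_left)
  moreover have "x + y \<in> left_multiples a" if "x \<in> left_multiples a" "y \<in> left_multiples a" for x y
    using that unfolding left_multiples_def by (auto simp: subring_add simp flip: distrib_right)
  ultimately show ?thesis
    using subsetD[OF left_multiples_subset[OF assms]] mult_left_multiples
    by (simp add: subring_def additive_subgroup_def)
qed

lemma ring_ideal_right_annihilator:
  assumes "a \<in> S"
  shows "ring_ideal (left_multiples a) (right_annihilator a)"
proof
  show "subring (left_multiples a)"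
    using assms by (rule subring_left_multiples)
  then show "additive_subgroup (right_annihilator a)"
    by (simp add: subring_def additive_subgroup_def right_annihilator_def zero add minus distrib_left)
  show "right_annihilator a \<subseteq> left_multiples a"
    by (auto simp: right_annihilator_def)
  fix r x assume r: "r \<in> left_multiples a" and x: "x \<in> right_annihilator a"
  have "r \<in> S" and x_mem: "x \<in> left_multiples a" "a * x \<in> T"
    using r x left_multiples_subset[OF assms] by (auto simp: right_annihilator_def)
  obtain s where "s \<in> S" "r = s * a"
    using r by (auto simp: left_multiples_def)
  then have "a * (r * x) = a * s * (a * x)" "a * s \<in> S"
    using assms by (simp_all add: mult.assoc subring_mult)
  then show "r * x \<in> right_annihilator a"
    using x_mem \<open>r \<in> S\<close> by (simp add: right_annihilator_def mult_left_multiples lmult)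
  show "x * r \<in> right_annihilator a"
    using x_mem r \<open>r \<in> S\<close> left_multiples_subset[OF assms] rmult[of "a * x" r]
    by (auto simp: right_annihilator_def mult_left_multiples mult.assoc)
qed

end

lemma ring_ideal_UNIV_iff: "ring_ideal UNIV T \<longleftrightarrow> two_sided_ideal T"
  by (auto simp: ring_ideal_def subring_def two_sided_ideal_def additive_subgroup_def)

section \<open>Semiprime ideals and Levitzki's theorem\<close>

locale semiprime_ideal = ring_ideal +
  assumes semiprime: "a \<in> S \<Longrightarrow> (\<And>r. r \<in> S \<Longrightarrow> a * r * a \<in> T) \<Longrightarrow> a \<in> T"

lemma (in semiprime_ideal) semiprime_ideal_right_annihilator:
  assumes "a \<in> S"
  shows "semiprime_ideal (left_multiples a) (right_annihilator a)"
proof (intro semiprime_ideal.intro semiprime_ideal_axioms.intro)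
  show "ring_ideal (left_multiples a) (right_annihilator a)"
    using assms by (rule ring_ideal_right_annihilator)
  fix y
  assume y: "y \<in> left_multiples a"
    and right_annihilator: "\<And>s. s \<in> left_multiples a \<Longrightarrow> y * s * y \<in> right_annihilator a"
  have "a * y \<in> T"
  proof (rule semiprime)
    show "a * y \<in> S"
      using y assms left_multiples_subset subring_mult by blast
    show "a * y * r * (a * y) \<in> T" if "r \<in> S" for r
      using that right_annihilator[of "r * a"]
      by (simp add: left_multiples_def right_annihilator_def mult.assoc)
  qed
  then show "y \<in> right_annihilator a"
    using y by (simp add: right_annihilator_def)
qed

text \<open>If \<open>c (r c)\<^sup>n\<^sup>+\<^sup>2 \<in> T\<close> for all \<open>r\<close>, then \<open>y\<^sup>n\<^sup>+\<^sup>2\<close> vanishes for all \<open>y\<close> in the semiprime ring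
  \<open>S c\<close> modulo the right annihilator of \<open>c\<close>. There \<open>a = y\<^sup>n\<^sup>+\<^sup>1\<close> squares to zero, so that
  \<open>a (x a)\<^sup>n\<^sup>+\<^sup>1\<close> vanishes for all \<open>x\<close>, and the induction hypothesis applies first to \<open>a\<close>, then to \<open>c\<close>.\<close>

lemma mem_semiprime_ideal_if_mult_pow_Suc_mem:
  assumes "semiprime_ideal S T" and "c \<in> S" and "\<And>r. r \<in> S \<Longrightarrow> c * pow_Suc (r * c) n \<in> T"
  shows "c \<in> T"
  using assms
proof (induction n arbitrary: S T c)
  case 0
  then show ?case by (simp add: semiprime_ideal.semiprime mult.assoc)
next
  case (Suc n)
  interpret semiprime_ideal S T by (fact Suc.prems(1))
  have Sc: "semiprime_ideal (left_multiples c) (right_annihilator c)"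
    using Suc.prems(2) by (rule semiprime_ideal_right_annihilator)
  then interpret Sc: semiprime_ideal "left_multiples c" "right_annihilator c" .
  have bounded_index: "pow_Suc y (Suc n) \<in> right_annihilator c" if "y \<in> left_multiples c" for y
    using Sc.subring_pow_Suc[OF that, of "Suc n"] that Suc.prems(3)
    by (auto simp: right_annihilator_def left_multiples_def)
  have "c * pow_Suc (r * c) n \<in> T" if "r \<in> S" for r
  proof -
    define a where "a = pow_Suc (r * c) n"
    have rc: "r * c \<in> left_multiples c"
      using that by (auto simp: left_multiples_def)
    then have a: "a \<in> left_multiples c"
      unfolding a_def by (rule Sc.subring_pow_Suc)
    have "a * a \<in> right_annihilator c"
      unfolding a_def pow_Suc_add using rc bounded_index[OF rc] by (rule Sc.pow_Suc_mono) simp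
    then have "a \<in> right_annihilator c"
      by (intro Suc.IH[OF Sc a] Sc.square_zero_mult_pow_Suc_mem[OF bounded_index a])
    then show ?thesis by (simp add: a_def right_annihilator_def)
  qed
  with Suc.prems(1,2) show ?case by (rule Suc.IH)
qed

context semiprime_ideal
begin

theorem levitzki:
  assumes "c \<in> S" and "\<And>r. r \<in> S \<Longrightarrow> pow_Suc (r * c) n \<in> T"
  shows "c \<in> T"
proof (rule mem_semiprime_ideal_if_mult_pow_Suc_mem)
  show "semiprime_ideal S T" by (rule semiprime_ideal_axioms)
  show "c * pow_Suc (r * c) n \<in> T" if "r \<in> S" for r
    using that assms lmult by simp
qed (fact assms(1))

lemma subset_if_bounded_index_translate:
  assumes "J \<subseteq> S" and "b \<in> S"
    and J_lmult: "\<And>r u. r \<in> S \<Longrightarrow> u \<in> J \<Longrightarrow> r * u \<in> J"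
    and J_mult_b: "\<And>u. u \<in> J \<Longrightarrow> u * b \<in> J"
    and b_nilpotent: "pow_Suc b m \<in> T"
    and bounded_index: "\<And>u. u \<in> J \<Longrightarrow> pow_Suc (b + u) n \<in> T"
  shows "J \<subseteq> T"
proof -
  have descent: "u \<in> T" if "u \<in> J" "u * b \<in> T" for u
  proof (rule levitzki)
    show "u \<in> S" using that assms(1) by blast
    fix r assume "r \<in> S"
    then have ru: "r * u \<in> J" "r * u * b \<in> T"
      using that J_lmult lmult by (simp_all add: mult.assoc)
    then have "r * u * pow_Suc (b + r * u) n \<in> T"
      using assms(1) bounded_index lmult by blast
    then show "pow_Suc (r * u) (Suc n) \<in> T"
      using mult_pow_Suc_mem_iff[of "r * u" "b + r * u"] ru assms(1,2) subring_add by auto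
  qed
  have "u \<in> T" if "u \<in> J" "u * pow_Suc b k \<in> T" for u k
    using that
  proof (induction k arbitrary: u)
    case 0
    then show ?case using descent by simp
  next
    case (Suc k)
    then have "u * b \<in> T"
      using J_mult_b by (simp add: mult.assoc)
    then show ?case using Suc.prems(1) descent by blast
  qed
  then show ?thesis
    using assms(1) b_nilpotent lmult by blast
qed

end

section \<open>The upper nilradical\<close>

lemma two_sided_ideal_sum_of_ideals:
  assumes "\<And>I. I \<in> \<I> \<Longrightarrow> two_sided_ideal I"
  shows "two_sided_ideal (sum_of_ideals \<I>)"
proof -
  have map_closed: "f x \<in> sum_of_ideals \<I>"
    if "x \<in> sum_of_ideals \<I>" "Modules.additive f" "\<And>I y. I \<in> \<I> \<Longrightarrow> y \<in> I \<Longrightarrow> f y \<in> I" for f x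
  proof -
    from that(1) obtain xs where "x = sum_list xs" "set xs \<subseteq> \<Union>\<I>"
      by (auto simp: sum_of_ideals_def)
    moreover have "f (sum_list xs) = sum_list (map f xs)"
      by (induction xs) (simp_all add: Modules.additive.zero Modules.additive.add that(2))
    moreover have "set (map f xs) \<subseteq> \<Union>\<I>"
      using that(3) \<open>set xs \<subseteq> \<Union>\<I>\<close> unfolding set_map by blast
    ultimately show ?thesis unfolding sum_of_ideals_def by blast
  qed
  have "x + y \<in> sum_of_ideals \<I>" if "x \<in> sum_of_ideals \<I>" "y \<in> sum_of_ideals \<I>" for x y
  proof -
    from that obtain xs ys where "x = sum_list xs" "y = sum_list ys" "set xs \<union> set ys \<subseteq> \<Union>\<I>"
      by (auto simp: sum_of_ideals_def)
    then have "x + y = sum_list (xs @ ys) \<and> set (xs @ ys) \<subseteq> \<Union>\<I>" by simp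
    then show ?thesis unfolding sum_of_ideals_def by blast
  qed
  moreover have "0 \<in> sum_of_ideals \<I>"
    unfolding sum_of_ideals_def by (intro CollectI exI[of _ "[]"]) simp
  moreover have "- x \<in> sum_of_ideals \<I>" "r * x \<in> sum_of_ideals \<I>" "x * r \<in> sum_of_ideals \<I>"
    if "x \<in> sum_of_ideals \<I>" for r x
    using assms
    by (auto intro!: map_closed[OF that]
        simp: Modules.additive_def distrib_left distrib_right two_sided_ideal_def additive_subgroup_def)
  ultimately show ?thesis
    by (simp add: two_sided_ideal_def additive_subgroup_def)
qed

lemma nilpotent_add_nil_ideal:
  assumes I: "two_sided_nil_ideal I" and "x \<in> I" and "nilpotent y"
  shows "nilpotent (x + y)"
proof -
  interpret ring_ideal UNIV I
    using I by (simp add: ring_ideal_UNIV_iff two_sided_nil_ideal_def)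
  obtain n where "pow_Suc y n = 0"
    using \<open>nilpotent y\<close> by (auto simp: nilpotent_def)
  then have "pow_Suc (x + y) n \<in> I"
    using pow_Suc_diff_mem[of "x + y" y n] \<open>x \<in> I\<close> by simp
  then show ?thesis
    using I nilpotent_pow_SucD by (auto simp: two_sided_nil_ideal_def)
qed

lemma two_sided_nil_ideal_sum_of_ideals:
  assumes "\<And>I. I \<in> \<I> \<Longrightarrow> two_sided_nil_ideal I"
  shows "two_sided_nil_ideal (sum_of_ideals \<I>)"
proof -
  have "nilpotent (sum_list xs)" if "set xs \<subseteq> \<Union>\<I>" for xs
    using that
  proof (induction xs)
    case Nil
    show ?case by (simp add: nilpotent_def exI[of _ 0])
  next
    case (Cons x xs)
    then show ?case
      using assms nilpotent_add_nil_ideal[of _ x "sum_list xs"] by auto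
  qed
  then show ?thesis
    using assms two_sided_ideal_sum_of_ideals[of \<I>]
    by (auto simp: two_sided_nil_ideal_def sum_of_ideals_def)
qed

lemma subset_sum_of_ideals: "I \<in> \<I> \<Longrightarrow> I \<subseteq> sum_of_ideals \<I>"
proof
  fix x assume "I \<in> \<I>" "x \<in> I"
  then show "x \<in> sum_of_ideals \<I>"
    unfolding sum_of_ideals_def by (intro CollectI exI[of _ "[x]"]) auto
qed

lemma sum_of_ideals_subset_iff:
  assumes "additive_subgroup S"
  shows "sum_of_ideals \<I> \<subseteq> S \<longleftrightarrow> (\<forall>I\<in>\<I>. I \<subseteq> S)"
proof (intro iffI)
  show "sum_of_ideals \<I> \<subseteq> S" if "\<forall>I\<in>\<I>. I \<subseteq> S"
  proof -
    have "sum_list xs \<in> S" if "set xs \<subseteq> S" for xs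
      using that assms by (induction xs) (auto simp: additive_subgroup_def)
    then show ?thesis
      using that unfolding sum_of_ideals_def by blast
  qed
qed (use subset_sum_of_ideals in blast)

lemma two_sided_ideal_with_cubes_mem:
  assumes "two_sided_ideal Q" and "\<And>r. a * r * a \<in> Q"
  obtains M where "two_sided_ideal M" "a \<in> M" "\<And>w. w \<in> M \<Longrightarrow> w * w * w \<in> Q"
proof
  interpret ring_ideal UNIV Q
    using assms(1) by (simp add: ring_ideal_UNIV_iff)
  define K where "K = {w. \<forall>r. w * r * a \<in> Q}"
  define M where "M = {w \<in> K. \<forall>k\<in>K. \<forall>r. k * r * w \<in> Q}"
  have "two_sided_ideal K"
    unfolding two_sided_ideal_def additive_subgroup_def K_def
    by (auto simp: zero add minus distrib_right mult.assoc intro: lmult)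
      (metis mult.assoc)
  then show "two_sided_ideal M"
    unfolding two_sided_ideal_def additive_subgroup_def M_def
    by (auto simp: zero add minus distrib_left rmult simp flip: mult.assoc)
  show "a \<in> M"
    using assms(2) by (simp add: M_def K_def)
  show "w * w * w \<in> Q" if "w \<in> M" for w
    using that by (simp add: M_def)
qed

lemma semiprime_ideal_upper_nilradical: "semiprime_ideal UNIV (upper_nilradical :: 'a::ring set)"
proof (intro semiprime_ideal.intro semiprime_ideal_axioms.intro)
  have nil: "two_sided_nil_ideal (upper_nilradical :: 'a set)"
    unfolding upper_nilradical_def by (rule two_sided_nil_ideal_sum_of_ideals) simp
  then have ideal: "two_sided_ideal (upper_nilradical :: 'a set)"
    by (simp add: two_sided_nil_ideal_def)
  then show "ring_ideal UNIV (upper_nilradical :: 'a set)"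
    by (simp add: ring_ideal_UNIV_iff)
  fix a :: 'a assume "\<And>r. r \<in> UNIV \<Longrightarrow> a * r * a \<in> upper_nilradical"
  then obtain M where M: "two_sided_ideal M" "a \<in> M"
    and cube: "\<And>w. w \<in> M \<Longrightarrow> w * w * w \<in> upper_nilradical"
    using two_sided_ideal_with_cubes_mem[OF ideal, of a] by auto
  have "nilpotent w" if "w \<in> M" for w
  proof (rule nilpotent_pow_SucD)
    show "nilpotent (pow_Suc w 2)"
      using cube[OF that] nil by (simp add: two_sided_nil_ideal_def numeral_2_eq_2 mult.assoc)
  qed
  with M have "M \<subseteq> upper_nilradical"
    unfolding upper_nilradical_def
    by (intro subset_sum_of_ideals) (simp add: two_sided_nil_ideal_def)
  with M(2) show "a \<in> upper_nilradical" by blast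
qed

section \<open>Compactness arguments\<close>

lemma open_Collect_ball_compact:
  assumes "compact K" and "open V" and "continuous_on UNIV (\<lambda>p. f (fst p) (snd p))"
  shows "open {x. \<forall>y\<in>K. f x y \<in> V}"
proof (subst open_subopen, intro ballI)
  let ?W = "(\<lambda>p. f (fst p) (snd p)) -` V"
  fix x assume "x \<in> {x. \<forall>y\<in>K. f x y \<in> V}"
  then have "{x} \<times> K \<subseteq> ?W" by auto
  moreover have "open ?W"
    using assms(2,3) by (rule open_vimage)
  ultimately have "\<exists>X. x \<in> X \<and> open X \<and> X \<times> K \<subseteq> ?W"
    by (intro Elementary_Topology.tube_lemma[OF assms(1)])
  then obtain X where "x \<in> X" "open X" "X \<times> K \<subseteq> ?W" by blast
  moreover from \<open>X \<times> K \<subseteq> ?W\<close> have "X \<subseteq> {x. \<forall>y\<in>K. f x y \<in> V}"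
    by (auto simp: subset_eq)
  ultimately show "\<exists>X. open X \<and> x \<in> X \<and> X \<subseteq> {x. \<forall>y\<in>K. f x y \<in> V}"
    by (intro exI conjI)
qed

lemma compact_ring_multiplicative_ideal_nhd:
  fixes U :: "'a::{ring, topological_semigroup_mult} set"
  assumes compact: "compact (UNIV :: 'a set)" and "open U" and "0 \<in> U"
  obtains I where "open I" "0 \<in> I" "I \<subseteq> U"
    "\<And>r h. h \<in> I \<Longrightarrow> r * h \<in> I" "\<And>r h. h \<in> I \<Longrightarrow> h * r \<in> I"
proof
  define L where "L = U \<inter> {h. \<forall>r\<in>UNIV. r * h \<in> U}"
  define I where "I = L \<inter> {h. \<forall>r\<in>UNIV. h * r \<in> L}"
  have "open L"
    unfolding L_def using compact \<open>open U\<close>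
    by (intro open_Int open_Collect_ball_compact continuous_intros)
  then show "open I"
    unfolding I_def using compact
    by (intro open_Int open_Collect_ball_compact continuous_intros)
  show "0 \<in> I" "I \<subseteq> U"
    using \<open>0 \<in> U\<close> by (auto simp: I_def L_def)
  have L_lmult: "r * h \<in> L" if "h \<in> L" for r h
    using that by (simp add: L_def flip: mult.assoc)
  show "r * h \<in> I" if "h \<in> I" for r h
    using that L_lmult by (simp add: I_def mult.assoc)
  show "h * r \<in> I" if "h \<in> I" for r h
    using that by (simp add: I_def mult.assoc)
qed

lemma compact_Hausdorff_Baire:
  fixes \<F> :: "'a::t2_space set set"
  assumes "compact (UNIV :: 'a set)" and "countable \<F>"
    and "\<And>F. F \<in> \<F> \<Longrightarrow> closed F" and "\<Union>\<F> = UNIV"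
  shows "\<exists>F\<in>\<F>. interior F \<noteq> {}"
proof -
  have "compact_space (euclidean :: 'a topology)"
    using assms(1) by (simp add: compact_space_def)
  moreover have "Hausdorff_space (euclidean :: 'a topology)"
    using hausdorff by (fastforce simp: Hausdorff_space_def disjnt_def)
  ultimately have "locally_compact_space (euclidean :: 'a topology)"
    "regular_space (euclidean :: 'a topology)"
    by (auto intro: compact_imp_locally_compact_space compact_Hausdorff_imp_regular_space)
  then show ?thesis
    using Baire_category_alt[of euclidean \<F>] assms(2-4) by auto
qed

lemma compact_nilpotent_bounded_pow_Suc_mem:
  fixes K :: "'a::{ring, topological_semigroup_mult} set"
  assumes "compact K" and nil: "\<And>y. y \<in> K \<Longrightarrow> nilpotent y" and "open V" and "0 \<in> V"
  shows "\<exists>n. \<forall>y\<in>K. \<exists>k\<le>n. pow_Suc y k \<in> V"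
proof -
  have "open ((\<lambda>y. pow_Suc y k) -` V)" for k
    using \<open>open V\<close> by (intro open_vimage continuous_intros)
  moreover have "K \<subseteq> (\<Union>k. (\<lambda>y. pow_Suc y k) -` V)"
  proof
    fix y assume "y \<in> K"
    then obtain k where "pow_Suc y k = 0"
      using nil by (auto simp: nilpotent_def)
    then have "y \<in> (\<lambda>y. pow_Suc y k) -` V"
      using \<open>0 \<in> V\<close> by simp
    then show "y \<in> (\<Union>k. (\<lambda>y. pow_Suc y k) -` V)" by blast
  qed
  ultimately obtain C where "finite C" "K \<subseteq> (\<Union>k\<in>C. (\<lambda>y. pow_Suc y k) -` V)"
    using compactE_image[OF \<open>compact K\<close>, of UNIV "\<lambda>k. (\<lambda>y. pow_Suc y k) -` V"] by metis
  then have "\<forall>y\<in>K. \<exists>k\<le>Max C. pow_Suc y k \<in> V"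
    using Max_ge[OF \<open>finite C\<close>] by blast
  then show ?thesis by (rule exI)
qed

lemma nilpotent_left_multiples_bounded_index:
  fixes x :: "'a::{ring, topological_ab_group_add, topological_semigroup_mult, t2_space}"
  assumes compact: "compact (UNIV :: 'a set)" and nil: "\<And>r. nilpotent (r * x)"
  obtains U r\<^sub>0 n where "open U" "0 \<in> U" "\<And>h. h \<in> U \<Longrightarrow> pow_Suc ((r\<^sub>0 + h) * x) n = 0"
proof -
  define F where "F n = {r. pow_Suc (r * x) n = 0}" for n
  have "closed (F n)" for n
    unfolding F_def by (intro closed_Collect_eq continuous_intros)
  moreover have "(\<Union>n. F n) = UNIV"
    using nil by (auto simp: F_def nilpotent_def)
  ultimately obtain n where "interior (F n) \<noteq> {}"
    using compact_Hausdorff_Baire[OF compact, of "range F"] by auto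
  then obtain r\<^sub>0 where r\<^sub>0: "r\<^sub>0 \<in> interior (F n)" by blast
  show thesis
  proof
    show "open ((+) r\<^sub>0 -` interior (F n))"
      by (intro open_vimage continuous_intros open_interior)
    show "0 \<in> (+) r\<^sub>0 -` interior (F n)"
      using r\<^sub>0 by simp
    show "pow_Suc ((r\<^sub>0 + h) * x) n = 0" if "h \<in> (+) r\<^sub>0 -` interior (F n)" for h
      using that interior_subset[of "F n"] by (auto simp: F_def)
  qed
qed

lemma semiprime_ideal_nhd_mult_mem:
  fixes x :: "'a::{ring, topological_ab_group_add, topological_semigroup_mult, t2_space}"
  assumes compact: "compact (UNIV :: 'a set)"
    and "semiprime_ideal UNIV Q"
    and nil: "\<And>r. nilpotent (r * x)"
  obtains V where "open V" "0 \<in> V" "\<And>h r. h \<in> V \<Longrightarrow> h * r * x \<in> Q"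
proof -
  interpret semiprime_ideal UNIV Q by (fact assms(2))
  obtain U r\<^sub>0 n where "open U" "0 \<in> U"
    and bounded_index: "\<And>h. h \<in> U \<Longrightarrow> pow_Suc ((r\<^sub>0 + h) * x) n = 0"
    using nilpotent_left_multiples_bounded_index[OF compact nil] by blast
  obtain I where I: "open I" "0 \<in> I" "I \<subseteq> U"
    and I_mult: "\<And>r h. h \<in> I \<Longrightarrow> r * h \<in> I" "\<And>r h. h \<in> I \<Longrightarrow> h * r \<in> I"
    using compact_ring_multiplicative_ideal_nhd[OF compact \<open>open U\<close> \<open>0 \<in> U\<close>] by blast
  obtain m where "pow_Suc (r\<^sub>0 * x) m = 0"
    using nil[of r\<^sub>0] by (auto simp: nilpotent_def)
  have "(\<lambda>h. h * x) ` I \<subseteq> Q"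
  proof (rule subset_if_bounded_index_translate)
    show "pow_Suc (r\<^sub>0 * x) m \<in> Q"
      using \<open>pow_Suc (r\<^sub>0 * x) m = 0\<close> zero by simp
    show "r * u \<in> (\<lambda>h. h * x) ` I" "u * (r\<^sub>0 * x) \<in> (\<lambda>h. h * x) ` I"
      if "u \<in> (\<lambda>h. h * x) ` I" for r u
      using that I_mult by (auto simp flip: mult.assoc)
    show "pow_Suc (r\<^sub>0 * x + u) n \<in> Q" if "u \<in> (\<lambda>h. h * x) ` I" for u
      using that I(3) bounded_index zero by (auto simp flip: distrib_right)
  qed simp_all
  then have "h * r * x \<in> Q" if "h \<in> I" for h r
    using I_mult(2)[OF that] by blast
  with I(1,2) show thesis by (rule that)
qed

lemma mem_semiprime_ideal_if_left_multiples_nilpotent: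
  fixes x :: "'a::{ring, topological_ab_group_add, topological_semigroup_mult, t2_space}"
  assumes compact: "compact (UNIV :: 'a set)"
    and "semiprime_ideal UNIV Q"
    and nil: "\<And>r. nilpotent (r * x)"
  shows "x \<in> Q"
proof -
  interpret semiprime_ideal UNIV Q by (fact assms(2))
  obtain V where V: "open V" "0 \<in> V" and mult_mem: "\<And>h r. h \<in> V \<Longrightarrow> h * r * x \<in> Q"
    using semiprime_ideal_nhd_mult_mem[OF assms] by blast
  have "compact (range (\<lambda>r. r * x))"
    by (intro compact_continuous_image[OF _ compact] continuous_intros)
  then have "\<exists>N. \<forall>y\<in>range (\<lambda>r. r * x). \<exists>k\<le>N. pow_Suc y k \<in> V"
    by (rule compact_nilpotent_bounded_pow_Suc_mem[OF _ _ V]) (use nil in auto)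
  then obtain N where N: "\<And>r. \<exists>k\<le>N. pow_Suc (r * x) k \<in> V"
    by auto
  show ?thesis
  proof (rule levitzki)
    fix r
    obtain k where "k \<le> N" "pow_Suc (r * x) k \<in> V" using N by blast
    then have "pow_Suc (r * x) k * r * x \<in> Q"
      by (intro mult_mem)
    then have "pow_Suc (r * x) (Suc k) \<in> Q"
      using pow_Suc_add[of "r * x" k 0] by (simp add: mult.assoc)
    then show "pow_Suc (r * x) (Suc N) \<in> Q"
      by (rule pow_Suc_mono[OF UNIV_I]) (simp add: \<open>k \<le> N\<close>)
  qed simp
qed

theorem mainTheorem1:
  assumes "compact (UNIV :: 'a::{ring, topological_ab_group_add, topological_semigroup_mult, t2_space} set)"
  shows "(sum_left_nil_ideals :: 'a set) = upper_nilradical"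
proof
  have N: "semiprime_ideal UNIV (upper_nilradical :: 'a set)"
    by (rule semiprime_ideal_upper_nilradical)
  have "L \<subseteq> upper_nilradical" if "left_nil_ideal L" for L :: "'a set"
    using mem_semiprime_ideal_if_left_multiples_nilpotent[OF assms N] that
    by (auto simp: left_nil_ideal_def left_ideal_def)
  moreover have "additive_subgroup (upper_nilradical :: 'a set)"
    using N by (simp add: semiprime_ideal_def ring_ideal_def)
  ultimately show "sum_left_nil_ideals \<subseteq> (upper_nilradical :: 'a set)"
    by (simp add: sum_left_nil_ideals_def sum_of_ideals_subset_iff)
  have "{I :: 'a set. two_sided_nil_ideal I} \<subseteq> {I. left_nil_ideal I}"
    by (auto simp: two_sided_nil_ideal_def left_nil_ideal_def two_sided_ideal_def left_ideal_def)
  then show "(upper_nilradical :: 'a set) \<subseteq> sum_left_nil_ideals"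
    unfolding upper_nilradical_def sum_left_nil_ideals_def sum_of_ideals_def by fast
qed

end
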